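(* Let $m,t$ be integers with $1\le t\le \frac m8$ and let $n=3m-t+2$. Suppose $\mathcal F\subset 2^{[n]}$ is $t$-pseudo partition-free, i.e., $\mathcal F$ does not contain three sets $A,B,C$ with $A\cup B=C$ and $|A\cap B|<t$. Then $$|\mathcal F|\le\sum_{k=m+1}^{2m-t+2}\binom nk.$$ *)

theory Defs
  imports Complex_Main
begin

(* A, B, C are arbitrary members of F, not required to be distinct. In particular the empty set
   together with B = C is a forbidden configuration, and so is A = B = C with card A < t. *)
definition pseudo_partition_free :: "nat \<Rightarrow> 'a set set \<Rightarrow> bool" where
  "pseudo_partition_free t F \<longleftrightarrow>
     \<not> (\<exists>A\<in>F. \<exists>B\<in>F. \<exists>C\<in>F. A \<union> B = C \<and> card (A \<inter> B) < t)"

end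

(* Call a_k the proportion of k-sets that belong to F. If X, Y, Z pairwise meet in t - 1 points and
   their sizes x, y, z add up to n + t - 1, then the unions have sizes n - x, n - y, n - z, and F
   contains at most four of X, Y, Z and their three unions. Averaging over all permutations
   of the ground set gives a_x + a_y + a_z + a_(n-x) + a_(n-y) + a_(n-z) <= 4. Used for
   (x, y, z) = (m+1, m, m), (m+1, m+1, m-1), (m+1, m+2, m-2), and for z < m - 2 with
   x, y in [m+2, n-m-2], this bounds a_z + a_(n-z) for the pairs of levels outside [m+1, n-m] by the
   losses 1 - a_k inside. As t <= m/8, binomial coefficients shrink by a factor 8/15 per level below
   m + 1, which is just enough for the losses to outweigh the gains. *)

theory Submission
  imports Defs "HOL-Combinatorics.Permutations"
begin

section \<open>Averaging over permutations of the ground set\<close>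

definition level_density :: "'a set \<Rightarrow> 'a set set \<Rightarrow> nat \<Rightarrow> real" where
  "level_density U F k = card {S\<in>F. card S = k} / (card U choose k)"

lemma exists_permutation_image:
  assumes "finite U" "S \<subseteq> U" "T \<subseteq> U" "card S = card T"
  obtains q where "q permutes U" "q ` S = T"
proof -
  have fin: "finite S" "finite T"
    using assms finite_subset by auto
  obtain f where f: "bij_betw f S T"
    using finite_same_card_bij[OF fin assms(4)] by blast
  have "card (U - S) = card (U - T)"
    using assms fin by (simp add: card_Diff_subset)
  then obtain g where g: "bij_betw g (U - S) (U - T)"
    using finite_same_card_bij assms(1) by blast
  define h where "h x = (if x \<in> S then f x else g x)" for x
  define q where "q x = (if x \<in> U then h x else x)" for x
  have hS: "bij_betw h S T"
    using f by (rule bij_betw_cong[THEN iffD1, rotated]) (simp add: h_def)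
  have hC: "bij_betw h (U - S) (U - T)"
    using g by (rule bij_betw_cong[THEN iffD1, rotated]) (simp add: h_def)
  have "bij_betw h (S \<union> (U - S)) (T \<union> (U - T))"
    using hS hC by (rule bij_betw_combine) auto
  then have hU: "bij_betw h U U"
    using assms by (simp add: Un_absorb1 Un_Diff_cancel)
  have "bij_betw q U U"
    using hU by (rule bij_betw_cong[THEN iffD1, rotated]) (simp add: q_def)
  then have "q permutes U"
    by (rule bij_imp_permutes) (simp add: q_def)
  moreover have "q ` S = T"
  proof -
    have "q ` S = h ` S"
      using assms by (auto simp: q_def intro!: image_cong)
    then show ?thesis
      using hS by (simp add: bij_betw_def)
  qed
  ultimately show thesis
    using that by blast
qed

text \<open>Sorting the permutations of \<open>U\<close> by the image of \<open>S\<close> gives one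
  class per set of size \<open>card S\<close>. Composing with a permutation that takes one image to
  another injects class into class, so all classes are equally large.\<close>

lemma card_permutations_mapping_set:
  assumes "finite U" "S \<subseteq> U" "T \<subseteq> U" "card S = card T"
  shows "card {p. p permutes U \<and> p ` S = T} * (card U choose card S) = fact (card U)"
proof -
  let ?N = "\<lambda>T. {p. p permutes U \<and> p ` S = T}"
  let ?L = "{R. R \<subseteq> U \<and> card R = card S}"
  have finP: "finite {p. p permutes U}"
    using assms by (simp add: finite_permutations)
  have le: "card (?N R) \<le> card (?N R')"
    if "R \<in> ?L" "R' \<in> ?L" for R R'
  proof -
    have R: "R \<subseteq> U" "R' \<subseteq> U" "card R = card R'"
      using that by auto
    obtain q where q: "q permutes U" "q ` R = R'"
      using exists_permutation_image[OF assms(1) R] .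
    show ?thesis
    proof (rule card_inj_on_le)
      show "inj_on ((\<circ>) q) (?N R)"
        using permutes_inj[OF q(1)] by (auto simp: inj_on_def fun_eq_iff dest: injD)
      show "((\<circ>) q) ` ?N R \<subseteq> ?N R'"
        using q by (auto simp: permutes_compose image_comp[symmetric])
      show "finite (?N R')"
        using finP by (rule rev_finite_subset) auto
    qed
  qed
  have "fact (card U) = card {p. p permutes U}"
    using card_permutations[OF refl assms(1)] by simp
  also have "{p. p permutes U} = (\<Union>R\<in>?L. ?N R)"
  proof (intro equalityI subsetI)
    fix p assume "p \<in> {p. p permutes U}"
    then have p: "p permutes U" by simp
    then have "p ` S \<subseteq> U"
      using permutes_image[OF p] assms by blast
    moreover have "card (p ` S) = card S"
      using permutes_inj_on[OF p] by (rule card_image)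
    ultimately show "p \<in> (\<Union>R\<in>?L. ?N R)"
      using p by auto
  qed auto
  also have "card \<dots> = (\<Sum>R\<in>?L. card (?N R))"
  proof (rule card_UN_disjoint)
    show "\<forall>R\<in>?L. finite (?N R)"
      using finP by (auto intro: rev_finite_subset)
  qed (use assms(1) in auto)
  also have "\<dots> = (\<Sum>R\<in>?L. card (?N T))"
    using le assms by (intro sum.cong refl antisym) auto
  also have "\<dots> = card (?N T) * (card U choose card S)"
    using n_subsets[OF assms(1), of "card S"] by simp
  finally show ?thesis ..
qed

text \<open>A random permutation sends \<open>S\<close> to a uniformly distributed set of its size.
  Thus a bound on how many sets of a configuration lie in \<open>F\<close> becomes a bound on a sum
  of densities.\<close>

lemma card_permutations_into_family:
  assumes "finite U" "F \<subseteq> Pow U" "S \<subseteq> U"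
  shows "(\<Sum>p | p permutes U. of_bool (p ` S \<in> F)) = fact (card U) * level_density U F (card S)"
proof -
  let ?L = "{T\<in>F. card T = card S}"
  let ?N = "\<lambda>T. {p. p permutes U \<and> p ` S = T}"
  have finP: "finite {p. p permutes U}"
    using assms by (simp add: finite_permutations)
  have finL: "finite ?L"
    using assms finite_subset[of F "Pow U"] by auto
  have pos: "(card U choose card S) > 0"
    using assms by (simp add: card_mono)
  have "(\<Sum>p | p permutes U. of_bool (p ` S \<in> F)) = real (card {p. p permutes U \<and> p ` S \<in> F})"
    using finP by (simp add: Collect_conj_eq)
  also have "{p. p permutes U \<and> p ` S \<in> F} = (\<Union>T\<in>?L. ?N T)"
    by (auto simp: card_image permutes_inj_on)
  also have "card \<dots> = (\<Sum>T\<in>?L. card (?N T))"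
  proof (rule card_UN_disjoint)
    show "\<forall>R\<in>?L. finite (?N R)"
      using finP by (auto intro: rev_finite_subset)
  qed (use finL in auto)
  also have "real \<dots> = (\<Sum>T\<in>?L. fact (card U) / (card U choose card S))"
  proof -
    have "real (card (?N T)) = fact (card U) / (card U choose card S)" if "T \<in> ?L" for T
    proof -
      have "card (?N T) * (card U choose card S) = fact (card U)"
        using card_permutations_mapping_set[of U S T] assms that by auto
      then have "real (card (?N T)) * (card U choose card S) = fact (card U)"
        by (metis of_nat_fact of_nat_mult)
      then show ?thesis
        using pos by (simp add: field_simps)
    qed
    then show ?thesis
      by simp
  qed
  finally show ?thesis
    by (simp add: level_density_def)
qed

lemma level_density_le_1:
  assumes "finite U" "F \<subseteq> Pow U"
  shows "level_density U F k \<le> 1"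
proof -
  have "card {S\<in>F. card S = k} \<le> card {S. S \<subseteq> U \<and> card S = k}"
    using assms by (intro card_mono) auto
  \<comment> \<open>For \<open>k > card U\<close> the density is a quotient by 0, hence 0.\<close>
  then show ?thesis
    using n_subsets[OF assms(1), of k] by (auto simp: level_density_def divide_le_eq_1 not_le)
qed

section \<open>Density inequalities from forbidden configurations\<close>

lemma level_density_eq_0:
  assumes "pseudo_partition_free t F" "k < t"
  shows "level_density U F k = 0"
proof -
  have no: "card S \<noteq> k" if "S \<in> F" for S
  proof
    assume "card S = k"
    \<comment> \<open>\<open>S\<close> serves as all three sets at once.\<close>
    then have "\<exists>A\<in>F. \<exists>B\<in>F. \<exists>C\<in>F. A \<union> B = C \<and> card (A \<inter> B) < t"
      using that assms(2) by (intro bexI[of _ S]) auto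
    then show False
      using assms(1) by (simp add: pseudo_partition_free_def)
  qed
  then have "{S\<in>F. card S = k} = {}"
    by auto
  then show ?thesis
    by (simp only: level_density_def) simp
qed

lemma pseudo_partition_free_image:
  assumes "pseudo_partition_free t F" "p permutes U" "card (X \<inter> Y) < t"
  shows "\<not> (p ` X \<in> F \<and> p ` Y \<in> F \<and> p ` (X \<union> Y) \<in> F)"
proof -
  have "card (p ` X \<inter> p ` Y) < t"
    using assms permutes_inj[OF assms(2)]
    by (simp add: image_Int[symmetric] card_image inj_on_subset)
  then show ?thesis
    using assms(1) by (auto simp: pseudo_partition_free_def image_Un)
qed

text \<open>No permutation maps all three sets into \<open>F\<close>, so each contributes at most 2
  to the sum. This replaces the three-set bound when the third set would have fewer than
  \<open>t\<close> elements.\<close>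

lemma two_set_density_bound:
  assumes F: "F \<subseteq> Pow U" "pseudo_partition_free t F" and U: "finite U"
    and XY: "X \<subseteq> U" "Y \<subseteq> U" "card (X \<inter> Y) < t"
  shows "level_density U F (card X) + level_density U F (card Y)
    + level_density U F (card (X \<union> Y)) \<le> 2"
proof -
  let ?a = "\<lambda>S. level_density U F (card S)"
  let ?f = "fact (card U) :: real"
  have "?f * (?a X + ?a Y + ?a (X \<union> Y)) =
    (\<Sum>p | p permutes U. of_bool (p ` X \<in> F) + of_bool (p ` Y \<in> F) + of_bool (p ` (X \<union> Y) \<in> F))"
    using XY by (simp only: sum.distrib card_permutations_into_family[OF U F(1)] Un_least distrib_left)
  also have "\<dots> \<le> (\<Sum>p | p permutes U. 2)"
  proof (rule sum_mono)
    fix p assume "p \<in> {p. p permutes U}"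
    then show "of_bool (p ` X \<in> F) + of_bool (p ` Y \<in> F) + of_bool (p ` (X \<union> Y) \<in> F) \<le> (2::real)"
      using pseudo_partition_free_image[OF F(2) _ XY(3)] by (auto simp: of_bool_def)
  qed
  also have "\<dots> = ?f * 2"
    by (simp add: card_permutations[OF refl U])
  finally show ?thesis
    by (simp only: mult_le_cancel_left_pos fact_gt_zero)
qed

text \<open>At least two of the six sets are missing from the family: every single set can be avoided by
  one of the three triples consisting of two of the given sets and their union.\<close>

lemma three_set_density_bound:
  assumes F: "F \<subseteq> Pow U" "pseudo_partition_free t F" and U: "finite U"
    and sub: "X \<subseteq> U" "Y \<subseteq> U" "Z \<subseteq> U"
    and int: "card (X \<inter> Y) < t" "card (X \<inter> Z) < t" "card (Y \<inter> Z) < t"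
  shows "level_density U F (card X) + level_density U F (card Y) + level_density U F (card Z)
    + level_density U F (card (X \<union> Y)) + level_density U F (card (X \<union> Z))
    + level_density U F (card (Y \<union> Z)) \<le> 4"
proof -
  let ?a = "\<lambda>S. level_density U F (card S)"
  let ?b = "\<lambda>p S. of_bool (p ` S \<in> F) :: real"
  let ?f = "fact (card U) :: real"
  have "?f * (?a X + ?a Y + ?a Z + ?a (X \<union> Y) + ?a (X \<union> Z) + ?a (Y \<union> Z)) =
    (\<Sum>p | p permutes U. ?b p X + ?b p Y + ?b p Z + ?b p (X \<union> Y) + ?b p (X \<union> Z) + ?b p (Y \<union> Z))"
    using sub by (simp only: sum.distrib card_permutations_into_family[OF U F(1)] Un_least distrib_left)
  also have "\<dots> \<le> (\<Sum>p | p permutes U. 4)"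
  proof (rule sum_mono)
    fix p assume "p \<in> {p. p permutes U}"
    then show "?b p X + ?b p Y + ?b p Z + ?b p (X \<union> Y) + ?b p (X \<union> Z) + ?b p (Y \<union> Z) \<le> 4"
      using pseudo_partition_free_image[OF F(2) _ int(1)] pseudo_partition_free_image[OF F(2) _ int(2)]
        pseudo_partition_free_image[OF F(2) _ int(3)]
      by (auto simp: of_bool_def)
  qed
  also have "\<dots> = ?f * 4"
    by (simp add: card_permutations[OF refl U])
  finally show ?thesis
    by (simp only: mult_le_cancel_left_pos fact_gt_zero)
qed

text \<open>The sets share a core of \<open>s = t - 1\<close> points, the largest intersection still
  forbidden, and are otherwise disjoint. Then a union such as \<open>X \<union> Y\<close> has
  \<open>x + y - s = n - z\<close> points. If \<open>z < t\<close>, level \<open>z\<close> is empty,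
  and two densities are bounded trivially by 1.\<close>

lemma complementary_levels_density_bound:
  assumes F: "F \<subseteq> Pow {1..n}" "pseudo_partition_free t F" and "1 \<le> t"
    and sum: "x + y + z + 1 = n + t" and le: "x \<le> n" "y \<le> n" "z \<le> n" and ge: "t \<le> x + 1" "t \<le> y + 1"
  defines "a \<equiv> level_density {1..n} F"
  shows "a x + a y + a z + a (n - x) + a (n - y) + a (n - z) \<le> 4"
proof -
  define s where "s = t - 1"
  have t: "t = s + 1"
    using assms(3) by (simp add: s_def)
  define X where "X = {1..x}"
  define Y where "Y = {1..s} \<union> {x<..x + y - s}"
  have XY: "X \<inter> Y = {1..s}"
    using ge t by (auto simp: X_def Y_def)
  have cX: "card X = x"
    by (simp add: X_def)
  have cY: "card Y = y"
    unfolding Y_def using ge t by (subst card_Un_disjoint) auto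
  have fin: "finite X" "finite Y"
    by (simp_all add: X_def Y_def)
  have cXY: "card (X \<union> Y) = n - z"
    using card_Un_Int[OF fin] XY cX cY sum t by simp
  have sub: "X \<subseteq> {1..n}" "Y \<subseteq> {1..n}"
    using sum le ge t by (auto simp: X_def Y_def)
  show ?thesis
  proof (cases "z < t")
    case True
    have "a z = 0"
      using level_density_eq_0[OF F(2) True] by (simp add: a_def)
    moreover have "a x + a y + a (n - z) \<le> 2"
      using two_set_density_bound[OF F finite_atLeastAtMost sub] XY cX cY cXY t
      by (simp add: a_def)
    moreover have "a (n - x) \<le> 1" "a (n - y) \<le> 1"
      using F(1) by (simp_all add: a_def level_density_le_1)
    ultimately show ?thesis
      by linarith
  next
    case False
    \<comment> \<open>The part outside the core starts right after \<open>Y\<close> and ends at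
      \<open>x + y + z - 2 * s = n - s\<close>, so it fits into the ground set.\<close>
    define Z where "Z = {1..s} \<union> {x + y - s<..x + y + z - 2 * s}"
    have XZ: "X \<inter> Z = {1..s}" and YZ: "Y \<inter> Z = {1..s}"
      using ge t False by (auto simp: X_def Y_def Z_def)
    have cZ: "card Z = z"
      unfolding Z_def using ge t False by (subst card_Un_disjoint) auto
    have finZ: "finite Z"
      by (simp add: Z_def)
    have cXZ: "card (X \<union> Z) = n - y"
      using card_Un_Int[OF fin(1) finZ] XZ cX cZ sum t by simp
    have cYZ: "card (Y \<union> Z) = n - x"
      using card_Un_Int[OF fin(2) finZ] YZ cY cZ sum t by simp
    have subZ: "Z \<subseteq> {1..n}"
      using sum le ge t by (auto simp: Z_def)
    show ?thesis
      using three_set_density_bound[OF F finite_atLeastAtMost sub subZ]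
        XY XZ YZ cX cY cZ cXY cXZ cYZ t
      by (simp add: a_def)
  qed
qed

section \<open>Estimates for binomial coefficients\<close>

lemma binomial_ratio_bound:
  assumes "15 * Suc k \<le> 8 * (n - k)"
  shows "15 * (n choose k) \<le> 8 * (n choose Suc k)"
proof -
  \<comment> \<open>Consecutive coefficients have ratio \<open>(k + 1) / (n - k)\<close>, at most
    8/15 by assumption.\<close>
  have eq: "Suc k * (n choose Suc k) = (n - k) * (n choose k)"
    by (metis binomial_absorb_comp binomial_absorption mult.commute)
  have "Suc k * (15 * (n choose k)) = (15 * Suc k) * (n choose k)"
    by (simp only: ac_simps)
  also have "\<dots> \<le> 8 * (n - k) * (n choose k)"
    using assms by (intro mult_right_mono) auto
  also have "\<dots> = Suc k * (8 * (n choose Suc k))"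
    using eq by (simp add: ac_simps)
  finally show ?thesis
    by (simp only: mult_le_cancel1)
qed

text \<open>Comparison with a geometric series of ratio 8/15, whose terms after the first sum to
  8/7. In the induction, 8 + 7 = 15 copies of \<open>n choose k\<close> are absorbed by 8 of the
  next coefficient.\<close>

lemma binomial_partial_sum_bound:
  assumes "15 * k \<le> 8 * (n + 1 - k)"
  shows "7 * (\<Sum>j<k. n choose j) \<le> 8 * (n choose k)"
  using assms
proof (induction k)
  case (Suc k)
  then have "7 * (\<Sum>j<k. n choose j) \<le> 8 * (n choose k)"
    by simp
  moreover have "15 * (n choose k) \<le> 8 * (n choose Suc k)"
    using Suc.prems by (intro binomial_ratio_bound) simp
  ultimately show ?case
    by simp
qed simp

text \<open>Unimodality; a \<open>k\<close> beyond the middle is reflected to \<open>n - k\<close>,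
  which is still at least \<open>l\<close>.\<close>

lemma binomial_ge_interval_end:
  assumes "l \<le> k" "k + l \<le> n"
  shows "n choose l \<le> n choose k"
proof (cases "2 * k \<le> n")
  case True
  then show ?thesis
    using assms by (intro binomial_mono) auto
next
  case False
  then have "n choose l \<le> n choose (n - k)"
    using assms by (intro binomial_mono) auto
  then show ?thesis
    using assms binomial_symmetric[of k n] by simp
qed

lemma card_eq_sum_level_density:
  assumes "finite U" "F \<subseteq> Pow U"
  shows "real (card F) = (\<Sum>k\<le>card U. (card U choose k) * level_density U F k)"
proof -
  have fin: "finite F"
    using assms finite_subset by auto
  have "card F = (\<Sum>S\<in>F. 1)"
    by simp
  also have "\<dots> = (\<Sum>k\<le>card U. \<Sum>S | S \<in> F \<and> card S = k. 1)"
    using assms fin by (intro sum.group[symmetric]) (auto intro!: card_mono)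
  finally have "real (card F) = (\<Sum>k\<le>card U. real (card {S\<in>F. card S = k}))"
    by simp
  also have "\<dots> = (\<Sum>k\<le>card U. (card U choose k) * level_density U F k)"
    by (intro sum.cong refl) (simp add: level_density_def)
  finally show ?thesis .
qed

section \<open>Gains on the outer levels against losses on the inner levels\<close>

theorem theorem6:
  fixes m t n :: nat and F :: "nat set set"
  assumes "1 \<le> t" and "real t \<le> real m / 8"
    and "n = 3 * m - t + 2"
    and "F \<subseteq> Pow {1..n}"
    and "pseudo_partition_free t F"
  shows "card F \<le> (\<Sum>k = m + 1..2 * m - t + 2. n choose k)"
proof -
  have tm: "8 * t \<le> m"
    using assms(2) by linarith
  have m: "8 \<le> m"
    using tm assms(1) by linarith
  have n: "n + t = 3 * m + 2"
    using assms(3) tm by simp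
  have top: "2 * m - t + 2 = n - m"
    using n tm by simp
  define a where "a = level_density {1..n} F"
  define b where "b k = real (n choose k)" for k
  \<comment> \<open>The losses \<open>d\<close> are split three ways: \<open>S\<close> is the
    weighted loss strictly inside, \<open>D\<close> the loss on the mirror levels
    \<open>m + 1\<close> and \<open>n - m - 1\<close> of common weight \<open>B\<close>, and level
    \<open>n - m\<close> is paired with \<open>m\<close>.\<close>
  define d where "d k = 1 - a k" for k
  define S where "S = (\<Sum>k = m + 2..n - m - 2. b k * d k)"
  define D where "D = d (m + 1) + d (n - m - 1)"
  define B where "B = b (m + 1)"
  have six: "a x + a y + a z + a (n - x) + a (n - y) + a (n - z) \<le> 4"
    if "x + y + z = 3 * m + 1" "x \<le> n" "y \<le> n" "z \<le> n" "t \<le> x" "t \<le> y" for x y z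
    unfolding a_def by (rule complementary_levels_density_bound[OF assms(4,5,1)]) (use that n in auto)
  have d0: "0 \<le> d k" for k
    using assms(4) by (simp add: d_def a_def level_density_le_1)
  have b0: "0 \<le> b k" for k
    by (simp add: b_def)
  have bsym: "b (n - k) = b k" if "k \<le> n" for k
    using binomial_symmetric[OF that] by (simp add: b_def)
  have Bpos: "0 < B"
    using n tm by (simp add: B_def b_def)
  have S0: "0 \<le> S"
    unfolding S_def by (intro sum_nonneg mult_nonneg_nonneg b0 d0)
  have D0: "0 \<le> D"
    by (simp add: D_def d0)
  \<comment> \<open>\<open>B\<close> is at most every coefficient on the levels inside, so a single
    loss there is at most \<open>S / B\<close>.\<close>
  have dS: "B * d k \<le> S" if "m + 2 \<le> k" "k \<le> n - m - 2" for k
  proof -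
    have "n choose (m + 1) \<le> n choose k"
      using that n tm by (intro binomial_ge_interval_end) auto
    then have "B * d k \<le> b k * d k"
      by (intro mult_right_mono d0) (simp add: B_def b_def)
    also have "\<dots> \<le> S"
      unfolding S_def using that by (intro member_le_sum) (auto simp: b0 d0)
    finally show ?thesis .
  qed

  \<comment> \<open>The critical case \<open>k = m\<close> reads
    \<open>15 * (m + 1) \<le> 8 * (2 * m - t + 2)\<close>, which follows from
    \<open>8 * t \<le> m\<close>.\<close>
  have ratio: "15 * b k \<le> 8 * b (k + 1)" if "k \<le> m" for k
  proof -
    have "15 * (n choose k) \<le> 8 * (n choose Suc k)"
      using that n tm by (intro binomial_ratio_bound) simp
    then show ?thesis
      unfolding b_def by simp
  qed
  have r0: "15 * b m \<le> 8 * B"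
    using ratio[of m] by (simp add: B_def)
  have r1: "15 * b (m - 1) \<le> 8 * b m" and r2: "15 * b (m - 2) \<le> 8 * b (m - 1)"
  proof -
    have "m - 1 + 1 = m" "m - 2 + 1 = m - 1"
      using m by simp_all
    then show "15 * b (m - 1) \<le> 8 * b m" "15 * b (m - 2) \<le> 8 * b (m - 1)"
      using ratio[of "m - 1"] ratio[of "m - 2"] by simp_all
  qed
  have "7 * (\<Sum>z<m - 2. n choose z) \<le> 8 * (n choose (m - 2))"
    using n tm by (intro binomial_partial_sum_bound) simp
  then have tail: "7 * (\<Sum>z<m - 2. b z) \<le> 8 * b (m - 2)"
    unfolding b_def by (simp flip: of_nat_sum)

  \<comment> \<open>Only \<open>a m\<close> counts as a gain here, since level \<open>n - m\<close>
    belongs to the bound; its loss stays on the right.\<close>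
  have e0: "2 * a m \<le> D + 2 * d (n - m)"
    using six[of "m + 1" m m] n tm by (simp add: D_def d_def)
  have e1: "a (m - 1) + a (n - (m - 1)) \<le> 2 * D"
  proof -
    have "m + 1 + (m + 1) + (m - 1) = 3 * m + 1" "m - 1 \<le> n" "m + 1 \<le> n" "t \<le> m + 1"
      using n tm m by auto
    then show ?thesis
      using six[of "m + 1" "m + 1" "m - 1"] by (simp add: D_def d_def)
  qed
  have e2: "a (m - 2) + a (n - (m - 2)) \<le> D + d (m + 2) + d (n - m - 2)"
  proof -
    have "m + 1 + (m + 2) + (m - 2) = 3 * m + 1" "m + 1 \<le> n" "m + 2 \<le> n" "m - 2 \<le> n"
      "t \<le> m + 1" "t \<le> m + 2"
      using n tm m by auto
    from six[OF this] show ?thesis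
      by (simp add: D_def d_def)
  qed
  have e2': "B * (a (m - 2) + a (n - (m - 2))) \<le> B * D + 2 * S"
  proof -
    have "B * (a (m - 2) + a (n - (m - 2))) \<le> B * (D + d (m + 2) + d (n - m - 2))"
      using e2 Bpos by (simp add: mult_left_mono)
    moreover have "B * d (m + 2) \<le> S" "B * d (n - m - 2) \<le> S"
      using n tm m by (intro dS; linarith)+
    ultimately show ?thesis
      by (simp add: distrib_left)
  qed
  have e3: "B * (a z + a (n - z)) \<le> 4 * S" if z: "z < m - 2" for z
  proof -
    \<comment> \<open>Halving \<open>3 * m + 1 - z \<ge> 2 * m + 4\<close> puts \<open>x\<close>,
      \<open>y\<close> and their mirror levels into the range of \<open>S\<close>; this is where
      \<open>z < m - 2\<close> is used.\<close>
    define x where "x = (3 * m + 1 - z) div 2"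
    define y where "y = 3 * m + 1 - z - x"
    have xy: "x + y + z = 3 * m + 1" "m + 2 \<le> x" "m + 2 \<le> y" "x \<le> n - m - 2" "y \<le> n - m - 2"
      using z n tm m by (auto simp: x_def y_def)
    have "a z + a (n - z) \<le> d x + d y + d (n - x) + d (n - y)"
      using six[of x y z] xy z n tm by (simp add: d_def)
    then have "B * (a z + a (n - z)) \<le> B * (d x + d y + d (n - x) + d (n - y))"
      using Bpos by (simp add: mult_left_mono)
    moreover have "B * d x \<le> S" "B * d y \<le> S" "B * d (n - x) \<le> S" "B * d (n - y) \<le> S"
      using xy n tm m by (intro dS; linarith)+
    ultimately show ?thesis
      by (simp add: distrib_left)
  qed

  let ?c = "\<lambda>z. a z + a (n - z)"
  have low: "(\<Sum>z<m. b z * ?c z) = (\<Sum>z<m - 2. b z * ?c z) + b (m - 2) * ?c (m - 2) + b (m - 1) * ?c (m - 1)"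
  proof -
    obtain q where "m = Suc (Suc q)"
      using that[of "m - 2"] m by linarith
    then show ?thesis
      by simp
  qed
  have "B * (\<Sum>z<m - 2. b z * ?c z) = (\<Sum>z<m - 2. b z * (B * ?c z))"
    by (simp add: sum_distrib_left ac_simps)
  also have "\<dots> \<le> (\<Sum>z<m - 2. b z * (4 * S))"
    by (intro sum_mono mult_left_mono e3 b0) auto
  also have "\<dots> = 4 * S * (\<Sum>z<m - 2. b z)"
    by (simp add: sum_distrib_left ac_simps)
  also have "\<dots> \<le> 4 * S * (8 / 7 * b (m - 2))"
    using tail S0 by (intro mult_left_mono) auto
  finally have l3: "B * (\<Sum>z<m - 2. b z * ?c z) \<le> 32 / 7 * b (m - 2) * S"
    by (simp add: ac_simps)
  have l2: "B * (b (m - 2) * ?c (m - 2)) \<le> b (m - 2) * (B * D + 2 * S)"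
    using mult_left_mono[OF e2' b0, of "m - 2"] by (simp add: ac_simps)
  have l1: "b (m - 1) * ?c (m - 1) \<le> 2 * b (m - 1) * D"
    using mult_left_mono[OF e1 b0, of "m - 1"] by simp
  have l0: "b m * a m \<le> b m * d (n - m) + 1 / 2 * b m * D"
    using mult_left_mono[OF e0 b0, of m] by (simp add: algebra_simps)
  \<comment> \<open>Three ratio steps lead from \<open>m - 2\<close> to \<open>m + 1\<close>:
    \<open>15 ^ 3 = 3375\<close> and \<open>8 ^ 3 = 512\<close>.\<close>
  have bm2: "3375 * b (m - 2) \<le> 512 * B"
    using r0 r1 r2 by linarith
  \<comment> \<open>The tail contributes 32/7 and level pair \<open>m - 2\<close> contributes 2,
    together 46/7. The next estimate holds because 46/7 * 512/3375 = 23552/23625 is below 1.\<close>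
  have "B * (\<Sum>z<m - 2. b z * ?c z) + B * (b (m - 2) * ?c (m - 2)) \<le> B * (b (m - 2) * D) + 46 / 7 * b (m - 2) * S"
    using l3 l2 by (simp add: algebra_simps)
  also have "\<dots> \<le> B * (b (m - 2) * D) + B * S"
    using bm2 Bpos S0 by (intro add_left_mono mult_right_mono) linarith+
  finally have "B * ((\<Sum>z<m - 2. b z * ?c z) + b (m - 2) * ?c (m - 2)) \<le> B * (b (m - 2) * D + S)"
    by (simp add: distrib_left)
  then have "(\<Sum>z<m - 2. b z * ?c z) + b (m - 2) * ?c (m - 2) \<le> b (m - 2) * D + S"
    using Bpos by simp
  then have "b m * a m + (\<Sum>z<m. b z * ?c z)
      \<le> b m * d (n - m) + (1 / 2 * b m + 2 * b (m - 1) + b (m - 2)) * D + S"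
    using low l1 l0 by (simp add: algebra_simps)
  \<comment> \<open>The coefficient of \<open>D\<close> is at most 4/15 + 128/225 + 512/3375 =
    3332/3375 times \<open>B\<close>.\<close>
  also have "\<dots> \<le> b m * d (n - m) + B * D + S"
    using r0 r1 r2 bm2 D0 Bpos by (intro add_right_mono add_left_mono mult_right_mono) linarith+
  also have "\<dots> = (\<Sum>k = m + 1..n - m. b k * d k)"
  proof -
    have "{m + 1..n - m} = insert (m + 1) (insert (n - m - 1) (insert (n - m) {m + 2..n - m - 2}))"
      using n tm m by auto
    moreover have "b (n - m) = b m" "b (n - m - 1) = B"
      using bsym[of m] bsym[of "m + 1"] n tm by (simp_all add: B_def)
    moreover have "m + 1 \<notin> insert (n - m - 1) (insert (n - m) {m + 2..n - m - 2})"
      "n - m - 1 \<notin> insert (n - m) {m + 2..n - m - 2}" "n - m \<notin> {m + 2..n - m - 2}"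
      using n tm m by auto
    ultimately show ?thesis
      by (simp only: sum.insert finite_insert finite_atLeastAtMost)
        (simp add: S_def D_def B_def distrib_left)
  qed
  finally have main: "b m * a m + (\<Sum>z<m. b z * ?c z) \<le> (\<Sum>k = m + 1..n - m. b k * d k)" .

  have "real (card F) = (\<Sum>k\<le>n. b k * a k)"
    using card_eq_sum_level_density[of "{1..n}" F] assms(4) by (simp add: a_def b_def)
  \<comment> \<open>The levels above \<open>n - m\<close> are the mirror images of those below
    \<open>m\<close>, so both can be summed as pairs with equal binomial coefficients.\<close>
  also have "{..n} = {..<m} \<union> {m} \<union> {m + 1..n - m} \<union> (\<lambda>z. n - z) ` {..<m}"
  proof -
    have "k \<in> (\<lambda>z. n - z) ` {..<m}" if "k \<le> n" "n - m < k" for k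
      using that by (intro image_eqI[of _ _ "n - k"]) auto
    then show ?thesis
      using n tm by (auto simp: not_le)
  qed
  also have "(\<Sum>k\<in>\<dots>. b k * a k) = (\<Sum>k<m. b k * a k) + b m * a m + (\<Sum>k = m + 1..n - m. b k * a k)
      + (\<Sum>k\<in>(\<lambda>z. n - z) ` {..<m}. b k * a k)"
    using n tm by (subst sum.union_disjoint; (auto; fail)?)+
  also have "(\<Sum>k\<in>(\<lambda>z. n - z) ` {..<m}. b k * a k) = (\<Sum>z<m. b z * a (n - z))"
    using n tm bsym by (subst sum.reindex) (auto simp: inj_on_def intro!: sum.cong)
  also have "(\<Sum>k<m. b k * a k) + b m * a m + (\<Sum>k = m + 1..n - m. b k * a k) + (\<Sum>z<m. b z * a (n - z))
      = b m * a m + (\<Sum>z<m. b z * ?c z) + (\<Sum>k = m + 1..n - m. b k * a k)"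
    by (simp add: distrib_left sum.distrib)
  \<comment> \<open>As \<open>a k + d k = 1\<close>, trading the outer gains for inner losses fills
    the inner levels completely.\<close>
  also have "\<dots> \<le> (\<Sum>k = m + 1..n - m. b k * d k) + (\<Sum>k = m + 1..n - m. b k * a k)"
    using main by simp
  also have "\<dots> = (\<Sum>k = m + 1..n - m. b k)"
    by (simp add: d_def algebra_simps flip: sum.distrib)
  finally have "real (card F) \<le> real (\<Sum>k = m + 1..n - m. n choose k)"
    by (simp add: b_def)
  then show ?thesis
    by (simp only: top of_nat_le_iff)
qed

end
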